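(* There is a hereditary $3$-graph property which admits zero $\mathrm{vdisc}_3$-error but which is not stable.
   Context: For distinct $x,y,z$ write $xyz=\{x,y,z\}$; $[n]=\{1,\dots,n\}$; $K_3[X,Y,Z]=\{xyz:x\in X,y\in Y,z\in Z\text{ pairwise distinct}\}$. A $3$-graph is a pair $H=(V,F)$ with $F\subseteq\binom V3$. A hereditary $3$-graph property is a class of finite $3$-graphs closed under isomorphism and induced sub-$3$-graphs. An equipartition is a partition whose parts differ in size by at most $1$. Stability: a graph $(W,E)$ has the $k$-order property if there are $a_1,\dots,a_k,b_1,\dots,b_k\in W$ with $a_ib_j\in E$ if and only if $i\leq j$; otherwise it is $k$-stable. For a $3$-graph $H=(V,F)$, $\mathrm{Graph}(H)$ is the bipartite graph with parts $V$ and $\binom V2$ and edges $\{ae:a\in V,e\in\binom V2,\{a\}\cup e\in F\}$. $H$ is $k$-stable if $\mathrm{Graph}(H)$ is $k$-stable; a hereditary $3$-graph property is stable if there is $k$ such that each of its members is $k$-stable. A $3$-partite $3$-graph $(U\cup V\cup W,F)$ with $|F|=d|U||V||W|$ has $\mathrm{vdisc}_3(\epsilon)$ if for all $U'\subseteq U$, $V'\subseteq V$, $W'\subseteq W$, $\big||F\cap K_3[U',V',W']|-d|U'||V'||W'|\big|\leq\epsilon|U||V||W|$. A hereditary $3$-graph property $\mathcal{H}$ admits zero $\mathrm{vdisc}_3$-error if for all $\epsilon>0$ and $t_0\geq1$ there are $T,N$ such that for every $H=(V,F)\in\mathcal{H}$ with $|V|\geq N$ there is an equipartition $\mathcal{P}$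 of $V$ into $t$ parts, $t_0\leq t\leq T$, such that for every three distinct parts $X,Y,Z\in\mathcal{P}$ the $3$-graph $(X\cup Y\cup Z,F\cap K_3[X,Y,Z])$ has $\mathrm{vdisc}_3(\epsilon)$. *)

theory Defs
  imports Complex_Main "HOL-Library.Disjoint_Sets"
begin

definition pairs :: "'a set \<Rightarrow> 'a set set" where
  "pairs V = {e. e \<subseteq> V \<and> card e = 2}"

definition triples :: "'a set \<Rightarrow> 'a set set" where
  "triples V = {e. e \<subseteq> V \<and> card e = 3}"

type_synonym 'a graph = "'a set \<times> 'a set set"
type_synonym 'a graph3 = "'a set \<times> 'a set set"

definition is_graph :: "'a graph \<Rightarrow> bool" where
  "is_graph G \<longleftrightarrow> snd G \<subseteq> pairs (fst G)"

definition is_graph3 :: "'a graph3 \<Rightarrow> bool" where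
  "is_graph3 H \<longleftrightarrow> snd H \<subseteq> triples (fst H)"

definition iso3 :: "'a graph3 \<Rightarrow> 'b graph3 \<Rightarrow> bool" where
  "iso3 H H' \<longleftrightarrow> (\<exists>f. bij_betw f (fst H) (fst H') \<and> snd H' = (\<lambda>e. f ` e) ` snd H)"

definition induced3 :: "'a graph3 \<Rightarrow> 'a set \<Rightarrow> 'a graph3" where
  "induced3 H U = (U, snd H \<inter> triples U)"

text \<open>A property is a set of 3-graphs with vertices in one fixed type. For an infinite
  vertex type every finite 3-graph has an isomorphic copy, so that sets closed under
  isomorphism correspond to isomorphism-closed classes of finite 3-graphs.\<close>

definition hereditary :: "'a graph3 set \<Rightarrow> bool" where
  "hereditary \<H> \<longleftrightarrow>
     (\<forall>H\<in>\<H>. finite (fst H) \<and> is_graph3 H) \<and>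
     (\<forall>H\<in>\<H>. \<forall>H'. is_graph3 H' \<and> iso3 H H' \<longrightarrow> H' \<in> \<H>) \<and>
     (\<forall>H\<in>\<H>. \<forall>U\<subseteq>fst H. induced3 H U \<in> \<H>)"

definition order_property :: "nat \<Rightarrow> 'a graph \<Rightarrow> bool" where
  "order_property k G \<longleftrightarrow>
     (\<exists>a b. (\<forall>i\<in>{1..k}. a i \<in> fst G \<and> b i \<in> fst G) \<and>
            (\<forall>i\<in>{1..k}. \<forall>j\<in>{1..k}. {a i, b j} \<in> snd G \<longleftrightarrow> i \<le> j))"

definition stable_graph :: "nat \<Rightarrow> 'a graph \<Rightarrow> bool" where
  "stable_graph k G \<longleftrightarrow> \<not> order_property k G"

definition Graph_of :: "'a graph3 \<Rightarrow> ('a + 'a set) graph" where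
  "Graph_of H =
     (Inl ` fst H \<union> Inr ` pairs (fst H),
      {{Inl a, Inr e} | a e. a \<in> fst H \<and> e \<in> pairs (fst H) \<and> {a} \<union> e \<in> snd H})"

lemma is_graph_Graph_of: "is_graph (Graph_of H)"
  by (auto simp: is_graph_def Graph_of_def pairs_def)

definition stable_graph3 :: "nat \<Rightarrow> 'a graph3 \<Rightarrow> bool" where
  "stable_graph3 k H \<longleftrightarrow> stable_graph k (Graph_of H)"

definition stable_property :: "'a graph3 set \<Rightarrow> bool" where
  "stable_property \<H> \<longleftrightarrow> (\<exists>k\<ge>1. \<forall>H\<in>\<H>. stable_graph3 k H)"

definition K3 :: "'a set \<Rightarrow> 'a set \<Rightarrow> 'a set \<Rightarrow> 'a set set" where
  "K3 X Y Z = {{x, y, z} | x y z. x \<in> X \<and> y \<in> Y \<and> z \<in> Z \<and> x \<noteq> y \<and> y \<noteq> z \<and> x \<noteq> z}"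

definition tripartite :: "'a set \<Rightarrow> 'a set \<Rightarrow> 'a set \<Rightarrow> 'a set set \<Rightarrow> bool" where
  "tripartite U V W F \<longleftrightarrow>
     disjnt U V \<and> disjnt V W \<and> disjnt U W \<and> F \<subseteq> K3 U V W"

definition vdisc3 :: "real \<Rightarrow> 'a set \<Rightarrow> 'a set \<Rightarrow> 'a set \<Rightarrow> 'a set set \<Rightarrow> bool" where
  "vdisc3 \<epsilon> U V W F \<longleftrightarrow> tripartite U V W F \<and>
     (\<exists>d::real. real (card F) = d * real (card U) * real (card V) * real (card W) \<and>
        (\<forall>U'\<subseteq>U. \<forall>V'\<subseteq>V. \<forall>W'\<subseteq>W.
           \<bar>real (card (F \<inter> K3 U' V' W'))
              - d * real (card U') * real (card V') * real (card W')\<bar>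
           \<le> \<epsilon> * real (card U) * real (card V) * real (card W)))"

definition equipartition :: "'a set \<Rightarrow> 'a set set \<Rightarrow> bool" where
  "equipartition V P \<longleftrightarrow> partition_on V P \<and> (\<forall>A\<in>P. \<forall>B\<in>P. card A \<le> card B + 1)"

definition zero_vdisc3_error :: "'a graph3 set \<Rightarrow> bool" where
  "zero_vdisc3_error \<H> \<longleftrightarrow>
     (\<forall>\<epsilon>::real. \<forall>t0::nat. \<epsilon> > 0 \<and> t0 \<ge> 1 \<longrightarrow>
       (\<exists>T N::nat. \<forall>H\<in>\<H>. card (fst H) \<ge> N \<longrightarrow>
         (\<exists>P. equipartition (fst H) P \<and> t0 \<le> card P \<and> card P \<le> T \<and>
           (\<forall>X\<in>P. \<forall>Y\<in>P. \<forall>Z\<in>P. X \<noteq> Y \<and> Y \<noteq> Z \<and> X \<noteq> Z \<longrightarrow>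
              vdisc3 \<epsilon> X Y Z (snd H \<inter> K3 X Y Z)))))"

end

(* Take the 3-graphs all of whose edges share a common vertex. Such a 3-graph has at most
   quadratically many edges, so every equipartition into boundedly many large parts has all its
   triples of parts of density close to 0, hence with vdisc3. But the link of the common vertex
   is an arbitrary graph, and if this is a half graph then the 3-graph has the order property. *)
theory Submission
  imports Defs
begin

text \<open>Induction on \<open>t\<close>, splitting off one part at a time. The size
  \<open>q\<close> is a free parameter, since \<open>card V div t\<close> would change as
  \<open>V\<close> shrinks; the two bounds on \<open>card V\<close> are the invariant that survives
  each removal.\<close>

lemma exists_partition_of_card:
  fixes V :: "'a set"
  assumes "finite V" "q \<ge> 1" "q * t \<le> card V" "card V \<le> (q + 1) * t"
  shows "\<exists>P. partition_on V P \<and> card P = t \<and> (\<forall>A\<in>P. q \<le> card A \<and> card A \<le> q + 1)"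
  using assms
proof (induction t arbitrary: V)
  case 0
  then have "V = {}" by simp
  then show ?case by (intro exI[of _ "{}"]) (simp add: partition_on_def)
next
  case (Suc t)
  \<comment> \<open>Take the larger size \<open>q + 1\<close> whenever this leaves at least
    \<open>q * t\<close> elements. Otherwise \<open>card V\<close> is exactly
    \<open>q + q * t\<close>, and size \<open>q\<close> fits.\<close>
  obtain s where s: "q \<le> s" "s \<le> q + 1" "s + q * t \<le> card V" "card V \<le> s + (q + 1) * t"
  proof (cases "q + 1 + q * t \<le> card V")
    case True
    show ?thesis by (rule that[of "q + 1"]) (use True Suc.prems in auto)
  next
    case False
    show ?thesis by (rule that[of q]) (use False Suc.prems in auto)
  qed
  then obtain A where A: "A \<subseteq> V" "card A = s" "finite A"
    using obtain_subset_with_card_n[of s V] by auto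
  have cd: "card (V - A) = card V - s"
    using A by (simp add: card_Diff_subset)
  obtain P where P: "partition_on (V - A) P" "card P = t"
      "\<forall>B\<in>P. q \<le> card B \<and> card B \<le> q + 1"
    using Suc.IH[of "V - A"] Suc.prems(1,2) s(3,4) cd by force
  have "finite P"
    using P(1) Suc.prems(1) finite_elements by blast
  have ne: "A \<noteq> {}" using A(2) s(1) \<open>q \<ge> 1\<close> by auto
  \<comment> \<open>Members of \<open>P\<close> lie in \<open>V - A\<close>, which cannot contain
    the nonempty set \<open>A\<close>. This makes the number of parts grow by one.\<close>
  have "A \<notin> P" using P(1) ne by (auto simp: partition_on_def)
  have "partition_on V (insert A P)"
    using P(1) ne A(1) partition_onD1[OF P(1)] partition_on_insert[of A P V]
    by (auto simp: disjnt_def)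
  then show ?case
    using P s A \<open>finite P\<close> \<open>A \<notin> P\<close> by (intro exI[of _ "insert A P"]) auto
qed

text \<open>Use part sizes \<open>card V div t\<close> and one more. The bound \<open>k\<close> is
  carried along because the density estimate later needs every part to be large.\<close>

lemma exists_equipartition:
  fixes V :: "'a set"
  assumes "finite V" "t \<ge> 1" "k \<ge> 1" "t * k \<le> card V"
  shows "\<exists>P. equipartition V P \<and> card P = t \<and> (\<forall>A\<in>P. k \<le> card A)"
proof -
  let ?q = "card V div t"
  have q: "k \<le> ?q" using assms
    by (simp add: less_eq_div_iff_mult_less_eq mult.commute)
  have "card V \<le> (?q + 1) * t"
    using dividend_less_div_times[of t "card V"] assms(2) by simp
  then obtain P where P: "partition_on V P" "card P = t" "\<forall>A\<in>P. ?q \<le> card A \<and> card A \<le> ?q + 1"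
    using exists_partition_of_card[of V ?q t] q assms by auto
  show ?thesis
    unfolding equipartition_def using P q
    by (intro exI[of _ P] conjI ballI) (auto intro: order_trans)
qed

text \<open>The vertex \<open>v\<close> ranges over the whole type, so edgeless 3-graphs belong to
  the class. Thus an induced sub-3-graph that loses \<open>v\<close>, and with it all edges, stays
  inside.\<close>

definition star :: "'a graph3 \<Rightarrow> bool" where
  "star H \<longleftrightarrow> finite (fst H) \<and> is_graph3 H \<and> (\<exists>v. \<forall>e\<in>snd H. v \<in> e)"

lemma hereditary_star: "hereditary (Collect star)"
  unfolding hereditary_def
proof (intro conjI ballI allI impI)
  fix H H' :: "'a graph3"
  assume "H \<in> Collect star" and H': "is_graph3 H' \<and> iso3 H H'"
  then obtain v where v: "finite (fst H)" "\<forall>e\<in>snd H. v \<in> e"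
    by (auto simp: star_def)
  obtain f where f: "bij_betw f (fst H) (fst H')" "snd H' = (\<lambda>e. f ` e) ` snd H"
    using H' by (auto simp: iso3_def)
  have "\<forall>e\<in>snd H'. f v \<in> e" using f(2) v(2) by auto
  then show "H' \<in> Collect star"
    using H' v(1) f(1) bij_betw_finite by (auto simp: star_def)
next
  fix H :: "'a graph3" and U
  assume "H \<in> Collect star" "U \<subseteq> fst H"
  then show "induced3 H U \<in> Collect star"
    by (auto simp: star_def induced3_def is_graph3_def intro: finite_subset)
qed (auto simp: star_def)

text \<open>The vertex \<open>v\<close> takes one of the three positions in each edge, and the other
  two vertices determine the edge. The three summands correspond to \<open>v\<close> in the place of
  \<open>X\<close>, \<open>Y\<close> or \<open>Z\<close>.\<close>

lemma card_star_K3_le: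
  assumes "finite X" "finite Y" "finite Z" "\<forall>e\<in>F. v \<in> e"
  shows "finite (F \<inter> K3 X Y Z)"
    and "card (F \<inter> K3 X Y Z) \<le> card Y * card Z + card X * card Z + card X * card Y"
proof -
  let ?I = "\<lambda>A B. (\<lambda>(x, y). {v, x, y}) ` (A \<times> B)"
  have sub: "F \<inter> K3 X Y Z \<subseteq> ?I Y Z \<union> ?I X Z \<union> ?I X Y"
  proof
    fix e assume e: "e \<in> F \<inter> K3 X Y Z"
    then obtain x y z where xyz: "e = {x, y, z}" "x \<in> X" "y \<in> Y" "z \<in> Z"
      by (auto simp: K3_def)
    have "v \<in> e" using e assms(4) by auto
    then consider "v = x" | "v = y" | "v = z" using xyz(1) by auto
    then show "e \<in> ?I Y Z \<union> ?I X Z \<union> ?I X Y"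
    proof cases
      case 1
      then have "e = {v, y, z}" using xyz by auto
      then show ?thesis using xyz by auto
    next
      case 2
      then have "e = {v, x, z}" using xyz by auto
      then show ?thesis using xyz by auto
    next
      case 3
      then have "e = {v, x, y}" using xyz by auto
      then show ?thesis using xyz by auto
    qed
  qed
  have fin: "finite (?I Y Z \<union> ?I X Z \<union> ?I X Y)" using assms by auto
  show "finite (F \<inter> K3 X Y Z)" using finite_subset[OF sub fin] .
  have I: "card (?I A B) \<le> card A * card B" if "finite A" "finite B" for A B
    using card_image_le[of "A \<times> B"] that by (simp add: card_cartesian_product)
  have "card (F \<inter> K3 X Y Z) \<le> card (?I Y Z \<union> ?I X Z \<union> ?I X Y)"
    by (rule card_mono[OF fin sub])
  also have "\<dots> \<le> card (?I Y Z) + card (?I X Z) + card (?I X Y)"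
    by (meson add_le_mono1 card_Un_le order_trans)
  also have "\<dots> \<le> card Y * card Z + card X * card Z + card X * card Y"
    by (intro add_mono I assms)
  finally show "card (F \<inter> K3 X Y Z) \<le> card Y * card Z + card X * card Z + card X * card Y" .
qed

text \<open>Both the actual count on \<open>U'\<close>, \<open>V'\<close>, \<open>W'\<close> and the
  predicted one lie between 0 and \<open>card F\<close>, so they differ by at most
  \<open>card F\<close>. Low density alone therefore gives \<open>vdisc3\<close>.\<close>

lemma vdisc3_of_sparse:
  assumes "tripartite U V W F" "finite F" "finite U" "finite V" "finite W"
    and ne: "U \<noteq> {}" "V \<noteq> {}" "W \<noteq> {}"
    and sparse: "real (card F) \<le> \<epsilon> * real (card U) * real (card V) * real (card W)"
  shows "vdisc3 \<epsilon> U V W F"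
proof -
  let ?p = "real (card U) * real (card V) * real (card W)"
  have p: "?p > 0" using assms by (simp add: card_gt_0_iff)
  define d where "d = real (card F) / ?p"
  have d0: "d \<ge> 0" using p by (simp add: d_def)
  have dp: "real (card F) = d * ?p"
    unfolding d_def times_divide_eq_left
    by (rule nonzero_mult_div_cancel_right[symmetric]) (use p in linarith)
  have "\<bar>real (card (F \<inter> K3 U' V' W')) - d * real (card U') * real (card V') * real (card W')\<bar>
      \<le> \<epsilon> * real (card U) * real (card V) * real (card W)"
    if "U' \<subseteq> U" "V' \<subseteq> V" "W' \<subseteq> W" for U' V' W'
  proof -
    have "card (F \<inter> K3 U' V' W') \<le> card F"
      using assms(2) by (intro card_mono) auto
    moreover have "d * (real (card U') * real (card V') * real (card W')) \<le> d * ?p"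
      using that assms d0 by (intro mult_left_mono mult_mono) (auto intro: card_mono)
    moreover have "d * (real (card U') * real (card V') * real (card W')) \<ge> 0"
      using d0 by simp
    ultimately have "\<bar>real (card (F \<inter> K3 U' V' W'))
        - d * (real (card U') * real (card V') * real (card W'))\<bar> \<le> real (card F)"
      unfolding dp[symmetric] abs_le_iff by linarith
    then show ?thesis using sparse by (simp add: mult.assoc)
  qed
  then show ?thesis
    unfolding vdisc3_def using assms(1) dp
    by (intro conjI exI[of _ d] allI impI) (simp_all only: mult.assoc)
qed

text \<open>The edge count is at most a sum of three products of two part sizes. Since every part
  has size at least 3 / \<open>\<epsilon>\<close>, each product is at most a third of the permitted
  error.\<close>

lemma vdisc3_star:
  assumes "finite X" "finite Y" "finite Z" "disjnt X Y" "disjnt Y Z" "disjnt X Z"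
    and large: "k \<le> card X" "k \<le> card Y" "k \<le> card Z"
    and k: "k \<ge> 1" "3 \<le> \<epsilon> * real k" and "\<epsilon> > 0" and v: "\<forall>e\<in>F. v \<in> e"
  shows "vdisc3 \<epsilon> X Y Z (F \<inter> K3 X Y Z)"
proof (rule vdisc3_of_sparse)
  let ?x = "real (card X)" and ?y = "real (card Y)" and ?z = "real (card Z)"
  have large': "3 \<le> \<epsilon> * real n" if "k \<le> n" for n
    using k(2) mult_left_mono[of "real k" "real n" \<epsilon>] \<open>\<epsilon> > 0\<close> that by linarith
  have "real (card (F \<inter> K3 X Y Z)) \<le> real (card Y * card Z + card X * card Z + card X * card Y)"
    using card_star_K3_le(2)[OF assms(1-3) v] by (simp only: of_nat_le_iff)
  moreover have "3 * (?y * ?z) \<le> (\<epsilon> * ?x) * (?y * ?z)"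
      "3 * (?x * ?z) \<le> (\<epsilon> * ?y) * (?x * ?z)" "3 * (?x * ?y) \<le> (\<epsilon> * ?z) * (?x * ?y)"
    using large by (intro mult_right_mono large'; simp)+
  ultimately show "real (card (F \<inter> K3 X Y Z)) \<le> \<epsilon> * ?x * ?y * ?z"
    by (simp add: algebra_simps)
  show "finite (F \<inter> K3 X Y Z)" by (rule card_star_K3_le(1)[OF assms(1-3) v])
  show "tripartite X Y Z (F \<inter> K3 X Y Z)" using assms by (simp add: tripartite_def)
qed (use assms in auto)

lemma zero_vdisc3_error_star: "zero_vdisc3_error (Collect star)"
  unfolding zero_vdisc3_error_def
proof (intro allI impI)
  fix \<epsilon> :: real and t0 :: nat
  assume *: "\<epsilon> > 0 \<and> t0 \<ge> 1"
  \<comment> \<open>Minimal part size: the 3 pays for the three summands in the edge bound.\<close>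
  define k where "k = nat \<lceil>3 / \<epsilon>\<rceil>"
  have "3 / \<epsilon> \<le> real k" unfolding k_def by (rule real_nat_ceiling_ge)
  then have k: "3 \<le> \<epsilon> * real k" using * by (simp add: divide_le_eq mult.commute)
  then have k1: "k \<ge> 1" by (cases k) auto
  \<comment> \<open>The witnesses are \<open>T = t0\<close> and \<open>N = t0 * k\<close>: exactly
    \<open>t0\<close> parts suffice, each with at least \<open>k\<close> vertices.\<close>
  have "\<exists>P. equipartition (fst H) P \<and> t0 \<le> card P \<and> card P \<le> t0 \<and>
      (\<forall>X\<in>P. \<forall>Y\<in>P. \<forall>Z\<in>P. X \<noteq> Y \<and> Y \<noteq> Z \<and> X \<noteq> Z \<longrightarrow>
         vdisc3 \<epsilon> X Y Z (snd H \<inter> K3 X Y Z))"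
    if H: "H \<in> Collect star" and N: "t0 * k \<le> card (fst H)" for H :: "'a graph3"
  proof -
    obtain v where fin: "finite (fst H)" and v: "\<forall>e\<in>snd H. v \<in> e"
      using H by (auto simp: star_def)
    obtain P where P: "equipartition (fst H) P" "card P = t0" "\<forall>A\<in>P. k \<le> card A"
      using exists_equipartition[of "fst H" t0 k] fin N k1 * by auto
    have part: "partition_on (fst H) P" using P(1) by (simp add: equipartition_def)
    have finP: "finite A" if "A \<in> P" for A
      using part that fin by (auto simp: partition_on_def intro: finite_subset)
    have disj: "disjnt A B" if "A \<in> P" "B \<in> P" "A \<noteq> B" for A B
      using partition_onD2[OF part] that by (auto simp: disjoint_def disjnt_def)
    have "vdisc3 \<epsilon> X Y Z (snd H \<inter> K3 X Y Z)"
      if "X \<in> P" "Y \<in> P" "Z \<in> P" "X \<noteq> Y \<and> Y \<noteq> Z \<and> X \<noteq> Z" for X Y Z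
      by (rule vdisc3_star[where k = k and v = v]) (use that P(3) v k k1 * in \<open>simp_all add: finP disj\<close>)
    then show ?thesis
      using P(1,2) by (intro exI[of _ P] conjI ballI impI) simp_all
  qed
  then show "\<exists>T N. \<forall>H\<in>Collect (star :: 'a graph3 \<Rightarrow> bool). N \<le> card (fst H) \<longrightarrow>
      (\<exists>P. equipartition (fst H) P \<and> t0 \<le> card P \<and> card P \<le> T \<and>
        (\<forall>X\<in>P. \<forall>Y\<in>P. \<forall>Z\<in>P. X \<noteq> Y \<and> Y \<noteq> Z \<and> X \<noteq> Z \<longrightarrow>
           vdisc3 \<epsilon> X Y Z (snd H \<inter> K3 X Y Z)))"
    by blast
qed

text \<open>The cone with apex 0 over the half graph with sides \<open>{1..k}\<close> and
  \<open>{k+1..2*k}\<close>; shifting by \<open>k\<close> keeps the sides disjoint.\<close>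

definition cone_half_graph :: "nat \<Rightarrow> nat graph3" where
  "cone_half_graph k =
     ({0..2 * k}, {{0, i, k + j} | i j. i \<in> {1..k} \<and> j \<in> {1..k} \<and> i \<le> j})"

lemma star_cone_half_graph: "star (cone_half_graph k)"
  by (auto simp: star_def cone_half_graph_def is_graph3_def triples_def)

lemma cone_half_graph_edge_iff:
  assumes "i \<in> {1..k}" "j \<in> {1..k}"
  shows "{i, 0, k + j} \<in> snd (cone_half_graph k) \<longleftrightarrow> i \<le> j"
proof
  assume "{i, 0, k + j} \<in> snd (cone_half_graph k)"
  then obtain i' j' where e: "{i, 0, k + j} = {0, i', k + j'}" "i' \<in> {1..k}" "j' \<in> {1..k}" "i' \<le> j'"
    by (auto simp: cone_half_graph_def)
  \<comment> \<open>Neither \<open>i\<close> nor \<open>k + j\<close> is 0, and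
    \<open>i \<le> k < k + j\<close>. Hence \<open>i = i'\<close> and \<open>j = j'\<close>, so an
    edge has only one representation.\<close>
  have "i \<in> {0, i', k + j'}" "k + j \<in> {0, i', k + j'}" unfolding e(1)[symmetric] by auto
  then show "i \<le> j" using assms e by auto
next
  assume "i \<le> j"
  moreover have "{i, 0, k + j} = {0, i, k + j}" by auto
  ultimately show "{i, 0, k + j} \<in> snd (cone_half_graph k)"
    using assms unfolding cone_half_graph_def snd_conv by blast
qed

text \<open>Joining the apex to one side of the half graph gives the pairs
  \<open>{0, k + j}\<close>. With the vertices \<open>i\<close> of the other side they witness the
  order property of length \<open>k\<close>.\<close>

lemma not_stable_cone_half_graph: "\<not> stable_graph3 k (cone_half_graph k)"
proof -
  have V: "i \<in> fst (cone_half_graph k)" "{0, k + i} \<in> pairs (fst (cone_half_graph k))"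
    if "i \<in> {1..k}" for i
    using that by (auto simp: cone_half_graph_def pairs_def)
  have "{Inl i, Inr {0, k + j}} \<in> snd (Graph_of (cone_half_graph k)) \<longleftrightarrow> i \<le> j"
    if "i \<in> {1..k}" "j \<in> {1..k}" for i j
    using V[OF that(1)] V[OF that(2)] cone_half_graph_edge_iff[OF that]
    by (auto simp: Graph_of_def doubleton_eq_iff)
  then have "order_property k (Graph_of (cone_half_graph k))"
    unfolding order_property_def using V
    by (intro exI[of _ Inl] exI[of _ "\<lambda>j. Inr {0, k + j}"]) (auto simp: Graph_of_def)
  then show ?thesis by (simp add: stable_graph3_def stable_graph_def)
qed

theorem proposition2p37:
  "\<exists>\<H> :: nat graph3 set.
     hereditary \<H> \<and> zero_vdisc3_error \<H> \<and> \<not> stable_property \<H>"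
  \<comment> \<open>The class contains \<open>cone_half_graph k\<close> for every \<open>k\<close>,
    so no single \<open>k\<close> bounds the order property on it.\<close>
  using hereditary_star zero_vdisc3_error_star star_cone_half_graph not_stable_cone_half_graph
  unfolding stable_property_def by blast

end
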